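(* Let $e:\mathbb R^{d+1}\to[0,\infty]$ be a one-sided e-statistic for $\psi=(\rho,\phi):\mathcal M\to\mathbb R\times\mathbb R^{d-1}$. Let $(L_t)_{t\in[T]}$ be losses adapted to a filtration $(\mathcal F_t)$, let $(r_t,z_t)$, $t\in[T]$, be $\mathcal F_{t-1}$-measurable forecasts, let $X_t=e(L_t,r_t,z_t)$, and let $\boldsymbol\lambda=(\lambda_t)_{t\in[T]}$ be a process with values in $[0,1]$ such that $\lambda_t$ is a function of $(L_{s-1},r_s,z_s)_{s\in[t]}$. Define $M_0(\boldsymbol\lambda)=1$ and $$M_t(\boldsymbol\lambda)=(1-\lambda_t+\lambda_tX_t)M_{t-1}(\boldsymbol\lambda)=\prod_{s=1}^t(1-\lambda_s+\lambda_sX_s),\qquad t\in[T].$$ Under the null hypothesis $$H_0:\quad r_t\ge\rho(L_t\mid\mathcal F_{t-1})\ \text{ and }\ z_t=\phi(L_t\mid\mathcal F_{t-1})\quad\text{for all }t\in[T],$$ the process $(M_t(\boldsymbol\lambda))_{t\in\{0,\dots,T\}}$ is a non-negative supermartingale (with respect to $(\mathcal F_t)$) with $M_0=1$, and for each $\alpha\in(0,1)$, $$\mathbb P\Big(\sup_{t\in\{0,\dots,T\}}M_t(\boldsymbol\lambda)\ge\frac1\alpha\Big)\le\alpha.$$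
   Context: $\mathcal M$ is a set of distributions on $\mathbb R$. A measurable function $e:\mathbb R^{d+1}\to[0,\infty]$ is a one-sided e-statistic for $\psi=(\rho,\phi)$ if $\int_{\mathbb R}e(x,r,\phi(F))\,\mathrm dF(x)\le1$ for each $F\in\mathcal M$ and each $r\ge\rho(F)$. $T$ is a time horizon, which may be fixed, infinite, or adaptive (depending on the data observed); $[T]=\{1,\dots,T\}$ (and $[T]=\mathbb N$, $\{0,\dots,T\}=\mathbb N\cup\{0\}$ if $T=\infty$). The $\sigma$-algebra $\mathcal F_t$ represents all information available up to time $t$. $\rho(L_t\mid\mathcal F_{t-1})$ and $\phi(L_t\mid\mathcal F_{t-1})$ denote the values of $\rho$ and $\phi$ at the conditional distribution of $L_t$ given $\mathcal F_{t-1}$ (assumed to lie in $\mathcal M$); they are $\mathcal F_{t-1}$-measurable random variables. $L_0$, which only enters as an argument of $\lambda_t$, is $\mathcal F_0$-measurable, and the functions defining $\lambda_t$ are measurable. *)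

theory Defs
  imports "HOL-Probability.Probability"
begin

text \<open>
  \<open>\<real>\<^sup>k\<close> is the product space below, so that \<open>k = 0\<close> (a one-point space) is covered; this is
  needed because a functional \<open>\<psi> = (\<rho>, \<phi>)\<close> with \<open>d = 1\<close> consists of \<open>\<rho>\<close> only.
\<close>

abbreviation Rvec :: "nat \<Rightarrow> (nat \<Rightarrow> real) measure" where
  "Rvec k \<equiv> PiM {..<k} (\<lambda>_. borel)"

definition one_sided_e_statistic ::
  "nat \<Rightarrow> real measure set \<Rightarrow> (real measure \<Rightarrow> real) \<Rightarrow> (real measure \<Rightarrow> nat \<Rightarrow> real) \<Rightarrow>
    (real \<times> real \<times> (nat \<Rightarrow> real) \<Rightarrow> ennreal) \<Rightarrow> bool" where
  "one_sided_e_statistic d \<M> \<rho> \<phi> e \<longleftrightarrow>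
     e \<in> borel_measurable (borel \<Otimes>\<^sub>M borel \<Otimes>\<^sub>M Rvec (d - 1)) \<and>
     (\<forall>F\<in>\<M>. \<forall>r\<ge>\<rho> F. (\<integral>\<^sup>+x. e (x, r, \<phi> F) \<partial>F) \<le> 1)"

text \<open>\<open>\<kappa>\<close> is a (regular) conditional distribution of \<open>X\<close> given the sub-\<open>\<sigma>\<close>-algebra \<open>G\<close>.\<close>

definition cond_distribution ::
  "'a measure \<Rightarrow> 'a measure \<Rightarrow> ('a \<Rightarrow> real) \<Rightarrow> ('a \<Rightarrow> real measure) \<Rightarrow> bool" where
  "cond_distribution P G X \<kappa> \<longleftrightarrow>
     \<kappa> \<in> G \<rightarrow>\<^sub>M prob_algebra borel \<and>
     (\<forall>B\<in>sets borel. AE \<omega> in P.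
        measure (\<kappa> \<omega>) B = real_cond_exp P G (\<lambda>\<omega>. indicator B (X \<omega>)) \<omega>)"

text \<open>A stopping time with values in \<open>{0, 1, \<dots>, \<infinity>}\<close>. (The library constant \<open>stopping_time\<close> requires
  the time and the index of the filtration to have the same type.) Constant horizons,
  finite or infinite, are special cases.\<close>

definition horizon :: "(nat \<Rightarrow> 'a measure) \<Rightarrow> ('a \<Rightarrow> enat) \<Rightarrow> bool" where
  "horizon F T \<longleftrightarrow> (\<forall>n. Measurable.pred (F n) (\<lambda>\<omega>. T \<omega> \<le> enat n))"

definition nonneg_supermartingale ::
  "'a measure \<Rightarrow> (nat \<Rightarrow> 'a measure) \<Rightarrow> (nat \<Rightarrow> 'a \<Rightarrow> ennreal) \<Rightarrow> bool" where
  "nonneg_supermartingale P F Y \<longleftrightarrow>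
     (\<forall>t. Y t \<in> borel_measurable (F t)) \<and>
     (\<forall>t. (\<integral>\<^sup>+\<omega>. Y t \<omega> \<partial>P) < \<infinity>) \<and>
     (\<forall>s t. s \<le> t \<longrightarrow> (AE \<omega> in P. nn_cond_exp P (F s) (Y t) \<omega> \<le> Y s \<omega>))"

text \<open>A process indexed by \<open>{0, \<dots>, T}\<close> is a supermartingale iff its extension, constant
  after time \<open>T\<close>, is one; only the values \<open>Y t \<omega>\<close> with \<open>t \<le> T \<omega>\<close> matter.\<close>

definition stopped :: "('a \<Rightarrow> enat) \<Rightarrow> (nat \<Rightarrow> 'a \<Rightarrow> 'b) \<Rightarrow> nat \<Rightarrow> 'a \<Rightarrow> 'b" where
  "stopped T Y t \<omega> = Y (the_enat (min (enat t) (T \<omega>))) \<omega>"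

definition nonneg_supermartingale_upto ::
  "'a measure \<Rightarrow> (nat \<Rightarrow> 'a measure) \<Rightarrow> ('a \<Rightarrow> enat) \<Rightarrow> (nat \<Rightarrow> 'a \<Rightarrow> ennreal) \<Rightarrow> bool" where
  "nonneg_supermartingale_upto P F T Y \<longleftrightarrow> nonneg_supermartingale P F (stopped T Y)"

text \<open>In \<^typ>\<open>ennreal\<close> we have \<open>0 * \<infinity> = 0\<close>, so not betting (\<open>\<lambda>\<^sub>s = 0\<close>) gives the factor \<open>1\<close> even if
  \<open>X\<^sub>s = \<infinity>\<close>.\<close>

definition e_process ::
  "(nat \<Rightarrow> 'a \<Rightarrow> real) \<Rightarrow> (nat \<Rightarrow> 'a \<Rightarrow> ennreal) \<Rightarrow> nat \<Rightarrow> 'a \<Rightarrow> ennreal" where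
  "e_process lam X t \<omega> = (\<Prod>s\<in>{1..t}. ennreal (1 - lam s \<omega>) + ennreal (lam s \<omega>) * X s \<omega>)"

lemma e_process_0: "e_process lam X 0 \<omega> = 1"
  by (simp add: e_process_def)

lemma e_process_rec:
  "t \<ge> 1 \<Longrightarrow> e_process lam X t \<omega> =
     (ennreal (1 - lam t \<omega>) + ennreal (lam t \<omega>) * X t \<omega>) * e_process lam X (t - 1) \<omega>"
  by (cases t) (simp_all add: e_process_def mult.commute)

end

theory Submission
  imports Defs
begin

text \<open>
  Freezing the bets after the horizon (\<open>\<lambda>\<^sub>s = 0\<close> for \<open>s > T\<close>) turns the stopped process into an
  ordinary product over all times, with predictable bets. Disintegrating the joint law of \<open>L\<^sub>t\<close> and
  the past along the conditional distribution \<open>\<kappa>\<^sub>t\<close>, the factor \<open>1 - \<lambda>\<^sub>t + \<lambda>\<^sub>t X\<^sub>t\<close> has conditional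
  mean at most \<open>1\<close>, because the forecasts act as constants in the e-statistic integrated against
  \<open>\<kappa>\<^sub>t\<close>. The probability bound is Ville's inequality.
\<close>

section \<open>Disintegration along a conditional distribution\<close>

text \<open>A conditional distribution is specified one event at a time, with a null set depending
  on the event. Integrating removes these null sets: on measurable rectangles the joint law of
  \<open>X\<close> and the identity into \<open>G\<close> agrees with the mixture of the fibre laws,
  and rectangles determine a finite measure. The second argument of \<open>f\<close> may therefore
  carry everything known in \<open>G\<close>.\<close>

lemma nn_integral_cond_distribution:
  assumes "prob_space P" and sub: "subalgebra P G"
    and X[measurable]: "X \<in> borel_measurable P"
    and \<kappa>: "cond_distribution P G X \<kappa>"
    and f[measurable]: "f \<in> borel_measurable (borel \<Otimes>\<^sub>M G)"
  shows "(\<integral>\<^sup>+\<omega>. f (X \<omega>, \<omega>) \<partial>P) = (\<integral>\<^sup>+\<omega>. (\<integral>\<^sup>+x. f (x, \<omega>) \<partial>\<kappa> \<omega>) \<partial>P)"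
proof -
  interpret P: prob_space P by fact
  interpret G: finite_measure_subalgebra P G
    by unfold_locales (fact sub)
  let ?G = "restr_to_subalg P G" and ?S = "borel \<Otimes>\<^sub>M G"
  \<comment> \<open>\<open>K \<omega>\<close> is the law of \<open>(x, \<omega>)\<close> with
    \<open>x\<close> drawn from \<open>\<kappa> \<omega>\<close> and \<open>\<omega>\<close> held
    fixed. It is a kernel on \<open>G\<close>, so it is mixed over \<open>?G\<close>, the measure
    \<open>P\<close> restricted to \<open>G\<close>.\<close>
  define K where "K \<omega> = distr (\<kappa> \<omega>) ?S (\<lambda>x. (x, \<omega>))" for \<omega>
  have \<kappa>p: "\<kappa> \<in> G \<rightarrow>\<^sub>M prob_algebra borel"
    and \<kappa>c: "\<And>B. B \<in> sets borel \<Longrightarrow>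
      AE \<omega> in P. measure (\<kappa> \<omega>) B = real_cond_exp P G (\<lambda>\<omega>. indicator B (X \<omega>)) \<omega>"
    using \<kappa> by (auto simp: cond_distribution_def)
  have \<kappa>s[measurable]: "\<kappa> \<in> G \<rightarrow>\<^sub>M subprob_algebra borel"
    using \<kappa>p by (rule measurable_prob_algebraD)
  have spG: "space G = space P" using sub by (simp add: subalgebra_def)
  have GP: "B \<in> sets P" if "B \<in> sets G" for B using sub that by (auto simp: subalgebra_def)
  have idG[measurable]: "(\<lambda>\<omega>. \<omega>) \<in> P \<rightarrow>\<^sub>M G"
    using measurable_from_subalg[OF sub measurable_ident] by (simp add: id_def)
  have \<kappa>prob: "prob_space (\<kappa> \<omega>)" and \<kappa>sets: "sets (\<kappa> \<omega>) = sets borel" if "\<omega> \<in> space P" for \<omega>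
    using measurable_space[OF \<kappa>p] that by (auto simp: space_prob_algebra spG)
  have KG: "K \<in> G \<rightarrow>\<^sub>M subprob_algebra ?S"
    unfolding K_def by (rule measurable_distr2[OF _ \<kappa>s]) measurable
  have KR: "K \<in> ?G \<rightarrow>\<^sub>M subprob_algebra ?S"
    by (rule measurable_in_subalg[OF sub KG])
  have intK: "(\<integral>\<^sup>+y. h y \<partial>K \<omega>) = (\<integral>\<^sup>+x. h (x, \<omega>) \<partial>\<kappa> \<omega>)"
    if "\<omega> \<in> space P" "h \<in> borel_measurable ?S" for h and \<omega>
  proof -
    have "(\<lambda>x. (x, \<omega>)) \<in> \<kappa> \<omega> \<rightarrow>\<^sub>M ?S"
      using that by (simp add: measurable_cong_sets[OF \<kappa>sets refl] spG)
    then show ?thesis using that(2) by (simp add: K_def nn_integral_distr)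
  qed
  let ?E = "{A \<times> B |A B. A \<in> sets (borel :: real measure) \<and> B \<in> sets G}"
  \<comment> \<open>The whole space is itself a rectangle of finite mass, so a constant sequence
    serves as the exhausting one.\<close>
  have joint: "distr P ?S (\<lambda>\<omega>. (X \<omega>, \<omega>)) = ?G \<bind> K"
  proof (rule measure_eqI_generator_eq[where A="\<lambda>_. space borel \<times> space G"])
    show "Int_stable ?E" by (rule Int_stable_pair_measure_generator)
    show "?E \<subseteq> Pow (space borel \<times> space G)"
      using sets.space_closed[of G] by auto
    show "sets (distr P ?S (\<lambda>\<omega>. (X \<omega>, \<omega>))) = sigma_sets (space borel \<times> space G) ?E"
      by (simp add: sets_pair_measure)
    show "sets (?G \<bind> K) = sigma_sets (space borel \<times> space G) ?E"
      by (subst sets_bind[where N="?S"])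
        (use KR P.not_empty in \<open>auto simp: sets_pair_measure space_restr_to_subalg dest: subprob_measurableD(2)\<close>)
    show "range (\<lambda>_. space borel \<times> space G) \<subseteq> ?E" by blast
    show "(\<Union>i::nat. space borel \<times> space G) = space borel \<times> space G" by simp
    interpret D: prob_space "distr P ?S (\<lambda>\<omega>. (X \<omega>, \<omega>))" by (rule P.prob_space_distr) measurable
    show "emeasure (distr P ?S (\<lambda>\<omega>. (X \<omega>, \<omega>))) (space borel \<times> space G) \<noteq> \<infinity>" for i :: nat by simp
  next
    fix C assume "C \<in> ?E"
    then obtain A B where C: "C = A \<times> B" and A[measurable]: "A \<in> sets borel" and B[measurable]: "B \<in> sets G"
      by auto
    have [measurable]: "B \<in> sets P" by (rule GP[OF B])
    let ?I = "\<lambda>\<omega>. indicator A (X \<omega>) :: real"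
    have intI: "integrable P ?I" by (intro P.integrable_const_bound[where B=1]) auto
    have mK: "(\<lambda>\<omega>. measure (\<kappa> \<omega>) A) \<in> borel_measurable G"
      by (rule measure_measurable_subprob_algebra2[OF _ \<kappa>s]) measurable
    have mKP[measurable]: "(\<lambda>\<omega>. measure (\<kappa> \<omega>) A) \<in> borel_measurable P"
      by (rule measurable_from_subalg[OF sub mK])
    have "emeasure (distr P ?S (\<lambda>\<omega>. (X \<omega>, \<omega>))) C = (\<integral>\<^sup>+\<omega>. ennreal (indicator B \<omega> * ?I \<omega>) \<partial>P)"
    proof -
      have "emeasure (distr P ?S (\<lambda>\<omega>. (X \<omega>, \<omega>))) C = emeasure P {\<omega> \<in> space P. X \<omega> \<in> A \<and> \<omega> \<in> B}"
        unfolding C by (subst emeasure_distr) (auto intro!: arg_cong[where f="emeasure P"])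
      also have "\<dots> = (\<integral>\<^sup>+\<omega>. indicator {\<omega> \<in> space P. X \<omega> \<in> A \<and> \<omega> \<in> B} \<omega> \<partial>P)"
        by (rule nn_integral_indicator[symmetric]) measurable
      also have "\<dots> = (\<integral>\<^sup>+\<omega>. ennreal (indicator B \<omega> * ?I \<omega>) \<partial>P)"
        by (intro nn_integral_cong) (auto split: split_indicator)
      finally show ?thesis .
    qed
    also have "\<dots> = ennreal (\<integral>\<omega>. indicator B \<omega> * ?I \<omega> \<partial>P)"
      by (intro nn_integral_eq_integral P.integrable_const_bound[where B=1]) (auto split: split_indicator)
    \<comment> \<open>Since \<open>B\<close> lies in \<open>G\<close>, the defining property of
      conditional expectation applies on it. The exceptional null set in the next step depends only
      on the fixed \<open>A\<close>.\<close>
    also have "(\<integral>\<omega>. indicator B \<omega> * ?I \<omega> \<partial>P) = (\<integral>\<omega>. indicator B \<omega> * real_cond_exp P G ?I \<omega> \<partial>P)"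
      using G.real_cond_exp_intA[OF intI B] by (simp add: set_lebesgue_integral_def)
    also have "\<dots> = (\<integral>\<omega>. indicator B \<omega> * measure (\<kappa> \<omega>) A \<partial>P)"
      using \<kappa>c[OF A] by (intro integral_cong_AE) auto
    also have "ennreal \<dots> = (\<integral>\<^sup>+\<omega>. ennreal (indicator B \<omega> * measure (\<kappa> \<omega>) A) \<partial>P)"
      by (intro nn_integral_eq_integral[symmetric] P.integrable_const_bound[where B=1])
        (use \<kappa>prob in \<open>auto split: split_indicator intro!: AE_I2 prob_space.prob_le_1\<close>)
    also have "\<dots> = (\<integral>\<^sup>+\<omega>. emeasure (K \<omega>) C \<partial>P)"
    proof (rule nn_integral_cong)
      fix \<omega> assume \<omega>: "\<omega> \<in> space P"
      interpret \<kappa>: prob_space "\<kappa> \<omega>" by (rule \<kappa>prob[OF \<omega>])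
      have "emeasure (K \<omega>) C = (\<integral>\<^sup>+y. indicator C y \<partial>K \<omega>)"
        by (rule nn_integral_indicator[symmetric]) (simp add: K_def C)
      also have "\<dots> = (\<integral>\<^sup>+x. indicator C (x, \<omega>) \<partial>\<kappa> \<omega>)"
        by (rule intK[OF \<omega>]) (simp add: C)
      also have "\<dots> = (\<integral>\<^sup>+x. indicator B \<omega> * indicator A x \<partial>\<kappa> \<omega>)"
        by (intro nn_integral_cong) (auto simp: C split: split_indicator)
      also have "\<dots> = indicator B \<omega> * emeasure (\<kappa> \<omega>) A"
        by (rule nn_integral_cmult_indicator) (simp add: \<kappa>sets[OF \<omega>])
      finally show "ennreal (indicator B \<omega> * measure (\<kappa> \<omega>) A) = emeasure (K \<omega>) C"
        by (simp add: \<kappa>.emeasure_eq_measure ennreal_mult split: split_indicator)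
    qed
    also have "\<dots> = (\<integral>\<^sup>+\<omega>. emeasure (K \<omega>) C \<partial>?G)"
      by (rule nn_integral_subalgebra2[OF sub, symmetric])
        (rule measurable_emeasure_kernel[OF KG], simp add: C)
    also have "\<dots> = emeasure (?G \<bind> K) C"
      by (rule emeasure_bind[OF _ KR, symmetric])
        (simp_all add: space_restr_to_subalg P.not_empty C)
    finally show "emeasure (distr P ?S (\<lambda>\<omega>. (X \<omega>, \<omega>))) C = emeasure (?G \<bind> K) C" .
  qed
  have "(\<integral>\<^sup>+\<omega>. f (X \<omega>, \<omega>) \<partial>P) = (\<integral>\<^sup>+y. f y \<partial>distr P ?S (\<lambda>\<omega>. (X \<omega>, \<omega>)))"
    by (rule nn_integral_distr[symmetric]) measurable
  also have "\<dots> = (\<integral>\<^sup>+\<omega>. (\<integral>\<^sup>+y. f y \<partial>K \<omega>) \<partial>?G)"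
    unfolding joint by (rule nn_integral_bind[OF f KR])
  also have "\<dots> = (\<integral>\<^sup>+\<omega>. (\<integral>\<^sup>+y. f y \<partial>K \<omega>) \<partial>P)"
    by (rule nn_integral_subalgebra2[OF sub])
      (rule measurable_compose[OF KG nn_integral_measurable_subprob_algebra[OF f]])
  also have "\<dots> = (\<integral>\<^sup>+\<omega>. (\<integral>\<^sup>+x. f (x, \<omega>) \<partial>\<kappa> \<omega>) \<partial>P)"
    by (intro nn_integral_cong intK f)
  finally show ?thesis .
qed

section \<open>Supermartingales through integrals over past events\<close>

text \<open>If the integral inequalities hold, test them on the event where the conditional
  expectation exceeds \<open>g\<close>: the excess is positive there but integrates to 0. Finiteness
  of the integral of \<open>g\<close> makes the subtraction legitimate in \<open>ennreal\<close>.
  One direction later establishes the supermartingale property, the other exploits it.\<close>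

lemma (in sigma_finite_subalgebra) nn_cond_exp_le_iff:
  assumes f[measurable]: "f \<in> borel_measurable M" and g[measurable]: "g \<in> borel_measurable F"
    and fin: "(\<integral>\<^sup>+x. g x \<partial>M) < \<infinity>"
  shows "(AE x in M. nn_cond_exp M F f x \<le> g x) \<longleftrightarrow>
    (\<forall>A\<in>sets F. (\<integral>\<^sup>+x\<in>A. f x \<partial>M) \<le> (\<integral>\<^sup>+x\<in>A. g x \<partial>M))"
proof -
  let ?h = "nn_cond_exp M F f"
  have [measurable]: "g \<in> borel_measurable M" by (rule measurable_from_subalg[OF subalg g])
  have sets: "A \<in> sets M" if "A \<in> sets F" for A
    using that subalg by (auto simp: subalgebra_def)
  have int: "(\<integral>\<^sup>+x\<in>A. f x \<partial>M) = (\<integral>\<^sup>+x\<in>A. ?h x \<partial>M)" if "A \<in> sets F" for A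
    using nn_cond_exp_intg[of "indicator A" f] that by (simp add: mult.commute)
  show ?thesis
  proof
    assume "AE x in M. ?h x \<le> g x"
    then show "\<forall>A\<in>sets F. (\<integral>\<^sup>+x\<in>A. f x \<partial>M) \<le> (\<integral>\<^sup>+x\<in>A. g x \<partial>M)"
      by (auto simp: int intro!: nn_integral_mono_AE mult_right_mono)
  next
    assume le: "\<forall>A\<in>sets F. (\<integral>\<^sup>+x\<in>A. f x \<partial>M) \<le> (\<integral>\<^sup>+x\<in>A. g x \<partial>M)"
    define A where "A = {x \<in> space F. g x < ?h x}"
    have AF: "A \<in> sets F" unfolding A_def by measurable
    have A[measurable]: "A \<in> sets M" by (rule sets[OF AF])
    have "(\<integral>\<^sup>+x\<in>A. ?h x \<partial>M) \<le> (\<integral>\<^sup>+x\<in>A. g x \<partial>M)"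
      using le[rule_format, OF AF] unfolding int[OF AF] .
    moreover have gfin: "(\<integral>\<^sup>+x\<in>A. g x \<partial>M) < \<infinity>"
      by (rule le_less_trans[OF _ fin]) (auto intro!: nn_integral_mono split: split_indicator)
    moreover have "(\<integral>\<^sup>+x. ?h x * indicator A x - g x * indicator A x \<partial>M) =
        (\<integral>\<^sup>+x\<in>A. ?h x \<partial>M) - (\<integral>\<^sup>+x\<in>A. g x \<partial>M)"
    proof (rule nn_integral_diff)
      show "AE x in M. g x * indicator A x \<le> ?h x * indicator A x"
        by (auto simp: A_def split: split_indicator)
    qed (use gfin in auto)
    \<comment> \<open>Subtraction is truncated at 0, so the inequality on \<open>A\<close> makes
      this difference vanish.\<close>
    ultimately have "(\<integral>\<^sup>+x. ?h x * indicator A x - g x * indicator A x \<partial>M) = 0"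
      by (simp add: diff_eq_0_iff_ennreal)
    then have "AE x in M. ?h x * indicator A x - g x * indicator A x = 0"
      by (subst (asm) nn_integral_0_iff_AE) auto
    then show "AE x in M. ?h x \<le> g x"
      using AE_space
    proof eventually_elim
      case (elim x)
      then show ?case using subalg
        by (cases "x \<in> A") (auto simp: A_def subalgebra_def diff_eq_0_iff_ennreal not_less)
    qed
  qed
qed

text \<open>An event of \<open>F s\<close> belongs to every later \<open>F t\<close>, so the
  one-step inequalities chain. Taken over the whole space, they carry integrability from time 0 to
  all times.\<close>

lemma nonneg_supermartingaleI:
  assumes "prob_space P" and filt: "filtration (space P) F" and sub: "\<And>t. subalgebra P (F t)"
    and Y: "\<And>t. Y t \<in> borel_measurable (F t)" and fin: "(\<integral>\<^sup>+\<omega>. Y 0 \<omega> \<partial>P) < \<infinity>"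
    and step: "\<And>t A. A \<in> sets (F t) \<Longrightarrow> (\<integral>\<^sup>+\<omega>\<in>A. Y (Suc t) \<omega> \<partial>P) \<le> (\<integral>\<^sup>+\<omega>\<in>A. Y t \<omega> \<partial>P)"
  shows "nonneg_supermartingale P F Y"
proof -
  interpret P: prob_space P by fact
  interpret filtration "space P" F by fact
  have mono: "(\<integral>\<^sup>+\<omega>\<in>A. Y t \<omega> \<partial>P) \<le> (\<integral>\<^sup>+\<omega>\<in>A. Y s \<omega> \<partial>P)" if "s \<le> t" "A \<in> sets (F s)" for s t A
    using that(1)
  proof (induction t rule: dec_induct)
    case (step t)
    then show ?case
      using assms(6)[where A=A and t=t] sets_F_mono[of s t] that(2) by (meson order_trans subsetD)
  qed simp
  have fin': "(\<integral>\<^sup>+\<omega>. Y t \<omega> \<partial>P) < \<infinity>" for t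
  proof -
    have "(\<integral>\<^sup>+\<omega>. Y s \<omega> \<partial>P) = (\<integral>\<^sup>+\<omega>\<in>space P. Y s \<omega> \<partial>P)" for s
      by (intro nn_integral_cong) simp
    then show ?thesis
      using mono[of 0 t "space P"] fin space_F[of 0] sets.top[of "F 0"] by (auto intro: le_less_trans)
  qed
  have "AE \<omega> in P. nn_cond_exp P (F s) (Y t) \<omega> \<le> Y s \<omega>" if "s \<le> t" for s t
  proof -
    interpret S: finite_measure_subalgebra P "F s"
      by unfold_locales (rule sub)
    show ?thesis
      using mono[OF that] measurable_from_subalg[OF sub Y]
      by (subst S.nn_cond_exp_le_iff) (auto simp: Y fin'[unfolded infinity_ennreal_def])
  qed
  then show ?thesis
    using Y fin' by (auto simp: nonneg_supermartingale_def)
qed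

section \<open>Maximal inequalities\<close>

text \<open>The bound is proved for each finite time span and passed to the limit by continuity from
  below. Keeping \<open>c\<close> as a factor on the left, instead of dividing by it, covers
  \<open>c = 0\<close> and \<open>c = \<infinity>\<close> uniformly.\<close>

lemma nonneg_supermartingale_maximal_inequality:
  assumes "prob_space P" and filt: "filtration (space P) F" and sub: "\<And>t. subalgebra P (F t)"
    and Y: "nonneg_supermartingale P F Y"
  shows "c * emeasure P {\<omega> \<in> space P. \<exists>t. c \<le> Y t \<omega>} \<le> (\<integral>\<^sup>+\<omega>. Y 0 \<omega> \<partial>P)"
proof -
  interpret P: prob_space P by fact
  interpret filtration "space P" F by fact
  have YF: "Y t \<in> borel_measurable (F t)" for t
    using Y by (simp add: nonneg_supermartingale_def)
  have [measurable]: "Y t \<in> borel_measurable P" for t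
    by (rule measurable_from_subalg[OF sub YF])
  \<comment> \<open>The level \<open>c\<close> has not been reached by time \<open>n\<close>. This
    event is known at time \<open>n\<close>, so the one-step inequality may be integrated over
    it.\<close>
  define N where "N n = {\<omega> \<in> space P. \<forall>t\<le>n. Y t \<omega> < c}" for n
  have [measurable]: "N n \<in> sets P" for n unfolding N_def by measurable
  have NF: "N n \<in> sets (F n)" for n
  proof -
    have "Y t \<in> borel_measurable (F n)" if "t \<le> n" for t
      using YF[of t] sets_F_mono[OF that] space_F by (auto simp: measurable_def)
    then have "{\<omega> \<in> space (F n). Y t \<omega> < c} \<in> sets (F n)" if "t \<in> {..n}" for t
      using that by (intro borel_measurable_less) auto
    then have "{\<omega> \<in> space (F n). \<forall>t\<in>{..n}. Y t \<omega> < c} \<in> sets (F n)"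
      by (rule sets.sets_Collect_finite_All') auto
    moreover have "N n = {\<omega> \<in> space (F n). \<forall>t\<in>{..n}. Y t \<omega> < c}"
      unfolding N_def space_F by blast
    ultimately show ?thesis by (simp only:)
  qed
  have step: "(\<integral>\<^sup>+\<omega>\<in>N n. Y (Suc n) \<omega> \<partial>P) \<le> (\<integral>\<^sup>+\<omega>\<in>N n. Y n \<omega> \<partial>P)" for n
  proof -
    interpret S: finite_measure_subalgebra P "F n"
      by unfold_locales (rule sub)
    have "AE \<omega> in P. nn_cond_exp P (F n) (Y (Suc n)) \<omega> \<le> Y n \<omega>" "(\<integral>\<^sup>+\<omega>. Y n \<omega> \<partial>P) < \<infinity>"
      using Y by (auto simp: nonneg_supermartingale_def)
    then show ?thesis
      using S.nn_cond_exp_le_iff[of "Y (Suc n)" "Y n"] YF NF by auto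
  qed
  \<comment> \<open>The left side is at most the mean of the process frozen on reaching level \<open>c\<close>,
    so optional stopping is not needed.\<close>
  have bound: "c * emeasure P (space P - N n) + (\<integral>\<^sup>+\<omega>\<in>N n. Y n \<omega> \<partial>P) \<le> (\<integral>\<^sup>+\<omega>. Y 0 \<omega> \<partial>P)" for n
  proof (induction n)
    case 0
    have "c * emeasure P (space P - N 0) + (\<integral>\<^sup>+\<omega>\<in>N 0. Y 0 \<omega> \<partial>P) =
        (\<integral>\<^sup>+\<omega>. c * indicator (space P - N 0) \<omega> + Y 0 \<omega> * indicator (N 0) \<omega> \<partial>P)"
      by (subst nn_integral_add) (auto simp: nn_integral_cmult_indicator)
    also have "\<dots> \<le> (\<integral>\<^sup>+\<omega>. Y 0 \<omega> \<partial>P)"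
      by (intro nn_integral_mono) (auto simp: N_def split: split_indicator)
    finally show ?case .
  next
    case (Suc n)
    have "space P - N (Suc n) = (space P - N n) \<union> (N n - N (Suc n))"
      by (auto simp: N_def)
    then have "emeasure P (space P - N (Suc n)) =
        emeasure P (space P - N n) + emeasure P (N n - N (Suc n))"
      by (simp only:) (rule plus_emeasure[symmetric]; auto)
    then have "c * emeasure P (space P - N (Suc n)) + (\<integral>\<^sup>+\<omega>\<in>N (Suc n). Y (Suc n) \<omega> \<partial>P) =
        c * emeasure P (space P - N n) +
        (c * emeasure P (N n - N (Suc n)) + (\<integral>\<^sup>+\<omega>\<in>N (Suc n). Y (Suc n) \<omega> \<partial>P))"
      by (simp add: distrib_left add.assoc)
    also have "c * emeasure P (N n - N (Suc n)) + (\<integral>\<^sup>+\<omega>\<in>N (Suc n). Y (Suc n) \<omega> \<partial>P) =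
        (\<integral>\<^sup>+\<omega>. c * indicator (N n - N (Suc n)) \<omega> + Y (Suc n) \<omega> * indicator (N (Suc n)) \<omega> \<partial>P)"
      by (subst nn_integral_add) (auto simp: nn_integral_cmult_indicator)
    \<comment> \<open>On \<open>N n - N (Suc n)\<close> the level is reached for the first time at
      \<open>Suc n\<close>, so there \<open>c\<close> is at most \<open>Y (Suc n)\<close>.\<close>
    also have "\<dots> \<le> (\<integral>\<^sup>+\<omega>\<in>N n. Y (Suc n) \<omega> \<partial>P)"
      by (intro nn_integral_mono) (auto simp: N_def le_Suc_eq not_less split: split_indicator)
    also have "\<dots> \<le> (\<integral>\<^sup>+\<omega>\<in>N n. Y n \<omega> \<partial>P)" by (rule step)
    finally show ?case using Suc.IH by (auto intro: order_trans add_left_mono)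
  qed
  have Un: "{\<omega> \<in> space P. \<exists>t. c \<le> Y t \<omega>} = (\<Union>n. space P - N n)"
    unfolding N_def by (blast intro: leI dest: leD)
  have "incseq (\<lambda>n. space P - N n)"
    unfolding incseq_def N_def by (blast intro: order_trans)
  then have "(SUP n. emeasure P (space P - N n)) = emeasure P (\<Union>n. space P - N n)"
    by (intro SUP_emeasure_incseq) auto
  then have "c * emeasure P {\<omega> \<in> space P. \<exists>t. c \<le> Y t \<omega>} = (SUP n. c * emeasure P (space P - N n))"
    unfolding Un using SUP_mult_left_ennreal[of c "\<lambda>n. emeasure P (space P - N n)" UNIV] by metis
  \<comment> \<open>The second, nonnegative summand of \<open>bound\<close> is dropped.\<close>
  also have "\<dots> \<le> (\<integral>\<^sup>+\<omega>. Y 0 \<omega> \<partial>P)"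
    using bound by (intro SUP_least) (meson le_iff_add order_trans)
  finally show ?thesis .
qed

text \<open>A supremum can equal \<open>c\<close> without being attained. Every level
  \<open>b < c\<close> is then still reached, so the maximal inequality is applied at
  \<open>b\<close>, and \<open>b\<close> increases to \<open>c\<close>.\<close>

lemma ville_inequality:
  assumes "prob_space P" and "filtration (space P) F" and sub: "\<And>t. subalgebra P (F t)"
    and Y: "nonneg_supermartingale P F Y"
  shows "c * emeasure P {\<omega> \<in> space P. c \<le> (SUP t. Y t \<omega>)} \<le> (\<integral>\<^sup>+\<omega>. Y 0 \<omega> \<partial>P)"
proof -
  have [measurable]: "Y t \<in> borel_measurable P" for t
    using Y measurable_from_subalg[OF sub] by (auto simp: nonneg_supermartingale_def)
  let ?S = "{\<omega> \<in> space P. c \<le> (SUP t. Y t \<omega>)}"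
  have "b * emeasure P ?S \<le> (\<integral>\<^sup>+\<omega>. Y 0 \<omega> \<partial>P)" if "b < c" for b
  proof -
    have "?S \<subseteq> {\<omega> \<in> space P. \<exists>t. b \<le> Y t \<omega>}"
    proof safe
      fix \<omega> assume "c \<le> (SUP t. Y t \<omega>)"
      then have "b < (SUP t. Y t \<omega>)" using that by (rule less_le_trans[rotated])
      then show "\<exists>t. b \<le> Y t \<omega>" by (auto simp: less_SUP_iff intro: less_imp_le)
    qed
    then have "b * emeasure P ?S \<le> b * emeasure P {\<omega> \<in> space P. \<exists>t. b \<le> Y t \<omega>}"
      by (intro mult_left_mono emeasure_mono) auto
    also have "\<dots> \<le> (\<integral>\<^sup>+\<omega>. Y 0 \<omega> \<partial>P)"
      by (rule nonneg_supermartingale_maximal_inequality[OF assms])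
    finally show ?thesis .
  qed
  then have "(SUP b\<in>{..<c}. b * emeasure P ?S) \<le> (\<integral>\<^sup>+\<omega>. Y 0 \<omega> \<partial>P)"
    by (auto intro: SUP_least)
  \<comment> \<open>This includes \<open>c = 0\<close>, where the index set is empty and the
    supremum in \<open>ennreal\<close> is 0.\<close>
  moreover have "(SUP b\<in>{..<c}. b) = c"
    by (rule antisym) (auto intro!: SUP_least dense_le simp: SUP_upper intro: less_imp_le)
  ultimately show ?thesis
    using SUP_mult_right_ennreal[of "\<lambda>b. b" "{..<c}" "emeasure P ?S"] by metis
qed

section \<open>A single bet\<close>

text \<open>The mean is a convex combination of 1, the total mass of \<open>D\<close>, and the mean
  of the e-statistic, which is at most 1. Membership of \<open>\<phi> D\<close> in the product space
  makes the section of \<open>e\<close> measurable.\<close>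

lemma one_sided_e_statistic_bet_le_one:
  assumes e: "one_sided_e_statistic d \<M> \<rho> \<phi> e" and D: "D \<in> \<M>" "real_distribution D"
    and r: "\<rho> D \<le> r" and z: "\<phi> D \<in> space (Rvec (d - 1))" and l: "0 \<le> l" "l \<le> 1"
  shows "(\<integral>\<^sup>+x. ennreal (1 - l) + ennreal l * e (x, r, \<phi> D) \<partial>D) \<le> 1"
proof -
  interpret real_distribution D by fact
  have [measurable]: "e \<in> borel_measurable (borel \<Otimes>\<^sub>M borel \<Otimes>\<^sub>M Rvec (d - 1))"
    and int: "(\<integral>\<^sup>+x. e (x, r, \<phi> D) \<partial>D) \<le> 1"
    using e D r by (auto simp: one_sided_e_statistic_def)
  have [measurable]: "(\<lambda>x. e (x, r, \<phi> D)) \<in> borel_measurable D"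
    using z by measurable
  have "(\<integral>\<^sup>+x. ennreal (1 - l) + ennreal l * e (x, r, \<phi> D) \<partial>D) =
      ennreal (1 - l) + ennreal l * (\<integral>\<^sup>+x. e (x, r, \<phi> D) \<partial>D)"
    using emeasure_space_1 by (simp add: nn_integral_add nn_integral_cmult)
  also have "\<dots> \<le> ennreal (1 - l) + ennreal l * 1"
    using int by (intro add_left_mono mult_left_mono) auto
  also have "\<dots> = 1"
    using l by (simp flip: ennreal_plus)
  finally show ?thesis .
qed

section \<open>Stopping at the horizon\<close>

text \<open>This turns the supremum up to a random horizon into a supremum over all times of the
  stopped process, to which Ville's inequality applies.\<close>

lemma range_stopped: "range (\<lambda>t. stopped T Y t \<omega>) = (\<lambda>t. Y t \<omega>) ` {t. enat t \<le> T \<omega>}"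
proof (intro equalityI subsetI)
  fix y assume "y \<in> range (\<lambda>t. stopped T Y t \<omega>)"
  then obtain t where y: "y = Y (the_enat (min (enat t) (T \<omega>))) \<omega>"
    by (auto simp: stopped_def)
  have "enat (the_enat (min (enat t) (T \<omega>))) \<le> T \<omega>"
    by (cases "T \<omega>") auto
  then show "y \<in> (\<lambda>t. Y t \<omega>) ` {t. enat t \<le> T \<omega>}"
    unfolding y by blast
next
  fix y assume "y \<in> (\<lambda>t. Y t \<omega>) ` {t. enat t \<le> T \<omega>}"
  then obtain t where "enat t \<le> T \<omega>" "y = Y t \<omega>" by auto
  then have "y = stopped T Y t \<omega>" by (simp add: stopped_def min_absorb1)
  then show "y \<in> range (\<lambda>t. stopped T Y t \<omega>)" by blast
qed

text \<open>A zero bet contributes the factor 1, even against an infinite payoff, so the factors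
  after the horizon may be added to the product.\<close>

lemma stopped_e_process:
  "stopped T (e_process lam X) t \<omega> =
     e_process (\<lambda>s \<omega>. if enat s \<le> T \<omega> then lam s \<omega> else 0) X t \<omega>"
proof -
  define n where "n = the_enat (min (enat t) (T \<omega>))"
  have n: "n \<le> t" "\<And>s. s \<le> n \<longleftrightarrow> s \<le> t \<and> enat s \<le> T \<omega>"
    unfolding n_def by (cases "T \<omega>"; auto)+
  have "stopped T (e_process lam X) t \<omega> =
      (\<Prod>s\<in>{1..n}. ennreal (1 - lam s \<omega>) + ennreal (lam s \<omega>) * X s \<omega>)"
    by (simp add: stopped_def e_process_def n_def)
  also have "\<dots> = e_process (\<lambda>s \<omega>. if enat s \<le> T \<omega> then lam s \<omega> else 0) X t \<omega>"
    unfolding e_process_def using n by (intro prod.mono_neutral_cong_left) auto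
  finally show ?thesis .
qed

section \<open>The betting process under the null hypothesis\<close>

text \<open>As \<open>\<rho>\<close> and \<open>\<phi>\<close> are arbitrary functionals, their
  values along \<open>\<kappa>\<close> need not be measurable; \<open>\<rho>L\<close> and
  \<open>\<phi>L\<close> are measurable versions that agree with them almost surely up to the
  horizon.\<close>

theorem theorem2:
  fixes P :: "'a measure" and F :: "nat \<Rightarrow> 'a measure" and T :: "'a \<Rightarrow> enat"
    and d :: nat and \<M> :: "real measure set"
    and \<rho> :: "real measure \<Rightarrow> real" and \<phi> :: "real measure \<Rightarrow> nat \<Rightarrow> real"
    and e :: "real \<times> real \<times> (nat \<Rightarrow> real) \<Rightarrow> ennreal"
    and L r :: "nat \<Rightarrow> 'a \<Rightarrow> real" and z :: "nat \<Rightarrow> 'a \<Rightarrow> nat \<Rightarrow> real"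
    and \<kappa> :: "nat \<Rightarrow> 'a \<Rightarrow> real measure"
    and \<rho>L :: "nat \<Rightarrow> 'a \<Rightarrow> real" and \<phi>L :: "nat \<Rightarrow> 'a \<Rightarrow> nat \<Rightarrow> real"
    and g :: "nat \<Rightarrow> (nat \<Rightarrow> real \<times> real \<times> (nat \<Rightarrow> real)) \<Rightarrow> real"
    and lam :: "nat \<Rightarrow> 'a \<Rightarrow> real"
    and X M :: "nat \<Rightarrow> 'a \<Rightarrow> ennreal"
  assumes prob: "prob_space P"
    and filt: "filtration (space P) F" "\<And>t. subalgebra P (F t)"
    and T: "horizon F T"
    and d: "1 \<le> d"
    and \<M>: "\<And>D. D \<in> \<M> \<Longrightarrow> real_distribution D"
    and \<phi>: "\<And>D. D \<in> \<M> \<Longrightarrow> \<phi> D \<in> space (Rvec (d - 1))"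
    and e: "one_sided_e_statistic d \<M> \<rho> \<phi> e"
    and L: "\<And>t. L t \<in> borel_measurable (F t)"
    and r: "\<And>t. 1 \<le> t \<Longrightarrow> r t \<in> borel_measurable (F (t - 1))"
    and z: "\<And>t. 1 \<le> t \<Longrightarrow> z t \<in> F (t - 1) \<rightarrow>\<^sub>M Rvec (d - 1)"
    and \<kappa>: "\<And>t. 1 \<le> t \<Longrightarrow> cond_distribution P (F (t - 1)) (L t) (\<kappa> t)"
    and \<kappa>_in: "\<And>t. 1 \<le> t \<Longrightarrow> AE \<omega> in P. enat t \<le> T \<omega> \<longrightarrow> \<kappa> t \<omega> \<in> \<M>"
    and \<rho>L: "\<And>t. 1 \<le> t \<Longrightarrow> \<rho>L t \<in> borel_measurable (F (t - 1))"
      "\<And>t. 1 \<le> t \<Longrightarrow> AE \<omega> in P. enat t \<le> T \<omega> \<longrightarrow> \<rho>L t \<omega> = \<rho> (\<kappa> t \<omega>)"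
    and \<phi>L: "\<And>t. 1 \<le> t \<Longrightarrow> \<phi>L t \<in> F (t - 1) \<rightarrow>\<^sub>M Rvec (d - 1)"
      "\<And>t. 1 \<le> t \<Longrightarrow> AE \<omega> in P. enat t \<le> T \<omega> \<longrightarrow> \<phi>L t \<omega> = \<phi> (\<kappa> t \<omega>)"
    and g: "\<And>t. 1 \<le> t \<Longrightarrow>
      g t \<in> borel_measurable (PiM {1..t} (\<lambda>_. borel \<Otimes>\<^sub>M borel \<Otimes>\<^sub>M Rvec (d - 1)))"
    and lam: "\<And>t \<omega>. 1 \<le> t \<Longrightarrow> \<omega> \<in> space P \<Longrightarrow> enat t \<le> T \<omega> \<Longrightarrow>
      lam t \<omega> = g t (\<lambda>s\<in>{1..t}. (L (s - 1) \<omega>, r s \<omega>, z s \<omega>))"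
      "\<And>t \<omega>. 1 \<le> t \<Longrightarrow> \<omega> \<in> space P \<Longrightarrow> enat t \<le> T \<omega> \<Longrightarrow> lam t \<omega> \<in> {0..1}"
    and X: "X = (\<lambda>t \<omega>. e (L t \<omega>, r t \<omega>, z t \<omega>))"
    and M: "M = e_process lam X"
    and H0: "AE \<omega> in P. \<forall>t\<ge>1. enat t \<le> T \<omega> \<longrightarrow> r t \<omega> \<ge> \<rho>L t \<omega> \<and> z t \<omega> = \<phi>L t \<omega>"
  shows "nonneg_supermartingale_upto P F T M \<and>
    (\<forall>\<omega>. M 0 \<omega> = 1) \<and>
    (\<forall>\<alpha>::real. 0 < \<alpha> \<and> \<alpha> < 1 \<longrightarrow>
      {\<omega> \<in> space P. (SUP t\<in>{t. enat t \<le> T \<omega>}. M t \<omega>) \<ge> ennreal (1 / \<alpha>)} \<in> sets P \<and>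
      measure P {\<omega> \<in> space P. (SUP t\<in>{t. enat t \<le> T \<omega>}. M t \<omega>) \<ge> ennreal (1 / \<alpha>)} \<le> \<alpha>)"
proof -
  interpret P: prob_space P by (rule prob)
  interpret filtration "space P" F by (rule filt)
  let ?R = "borel \<Otimes>\<^sub>M borel \<Otimes>\<^sub>M Rvec (d - 1)"
  have mono: "f \<in> F t \<rightarrow>\<^sub>M N" if "f \<in> F s \<rightarrow>\<^sub>M N" "s \<le> t" for f s t and N :: "'b measure"
    using that(1) sets_F_mono[OF that(2)] space_F by (auto simp: measurable_def)
  have e_meas: "e \<in> borel_measurable ?R"
    using e by (simp add: one_sided_e_statistic_def)
  \<comment> \<open>The values of \<open>lam\<close> beyond the horizon are unconstrained; replacing
    them by 0 yields bets in the unit interval at all times from 1 on.\<close>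
  define l where "l t \<omega> = (if enat t \<le> T \<omega> then lam t \<omega> else 0)" for t \<omega>
  define Y where "Y = e_process l X"
  have Y_eq: "stopped T M t \<omega> = Y t \<omega>" for t \<omega>
    unfolding Y_def M l_def[abs_def] by (rule stopped_e_process)
  have l01: "0 \<le> l t \<omega>" "l t \<omega> \<le> 1" if "1 \<le> t" "\<omega> \<in> space P" for t \<omega>
    using lam(2)[OF that] by (auto simp: l_def)
  have l_meas: "l t \<in> borel_measurable (F (t - 1))" if t: "1 \<le> t" for t
  proof -
    have "Measurable.pred (F (t - 1)) (\<lambda>\<omega>. \<not> T \<omega> \<le> enat (t - 1))"
      using T by (intro pred_intros_logic) (auto simp: horizon_def)
    moreover have "(\<not> T \<omega> \<le> enat (t - 1)) = (enat t \<le> T \<omega>)" for \<omega>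
      using t by (cases "T \<omega>") auto
    ultimately have A: "Measurable.pred (F (t - 1)) (\<lambda>\<omega>. enat t \<le> T \<omega>)" by simp
    \<comment> \<open>Losses enter only up to index \<open>t - 1\<close>, and the forecasts for time
      \<open>s\<close> are known at \<open>s - 1\<close>.\<close>
    have "(\<lambda>\<omega>. \<lambda>s\<in>{1..t}. (L (s - 1) \<omega>, r s \<omega>, z s \<omega>)) \<in> F (t - 1) \<rightarrow>\<^sub>M PiM {1..t} (\<lambda>_. ?R)"
    proof (rule measurable_restrict)
      fix s assume "s \<in> {1..t}"
      then have s: "1 \<le> s" "s - 1 \<le> t - 1" by auto
      show "(\<lambda>\<omega>. (L (s - 1) \<omega>, r s \<omega>, z s \<omega>)) \<in> F (t - 1) \<rightarrow>\<^sub>M ?R"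
        by (intro measurable_Pair mono[OF L s(2)] mono[OF r s(2)] mono[OF z s(2)] s(1))
    qed
    then have "(\<lambda>\<omega>. g t (\<lambda>s\<in>{1..t}. (L (s - 1) \<omega>, r s \<omega>, z s \<omega>))) \<in> borel_measurable (F (t - 1))"
      by (rule measurable_compose[OF _ g[OF t]])
    then have "(\<lambda>\<omega>. if enat t \<le> T \<omega> then g t (\<lambda>s\<in>{1..t}. (L (s - 1) \<omega>, r s \<omega>, z s \<omega>)) else 0)
        \<in> borel_measurable (F (t - 1))"
      using A by (intro measurable_If) (auto simp: pred_def)
    then show ?thesis
      by (rule measurable_cong[THEN iffD1, rotated]) (use lam(1)[OF t] in \<open>auto simp: l_def space_F\<close>)
  qed
  have X_meas: "X t \<in> borel_measurable (F t)" if t: "1 \<le> t" for t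
    unfolding X
    by (intro measurable_compose[OF _ e_meas] measurable_Pair L
        mono[OF r[OF t]] mono[OF z[OF t]]) auto
  have Y_meas: "Y t \<in> borel_measurable (F t)" for t
    unfolding Y_def e_process_def[abs_def]
  proof (rule borel_measurable_prod_ennreal)
    fix s assume "s \<in> {1..t}"
    then have s: "1 \<le> s" "s - 1 \<le> t" "s \<le> t" by auto
    note [measurable] = mono[OF l_meas[OF s(1)] s(2)] mono[OF X_meas[OF s(1)] s(3)]
    show "(\<lambda>\<omega>. ennreal (1 - l s \<omega>) + ennreal (l s \<omega>) * X s \<omega>) \<in> borel_measurable (F t)"
      by measurable
  qed
  have step: "(\<integral>\<^sup>+\<omega>\<in>A. Y (Suc t) \<omega> \<partial>P) \<le> (\<integral>\<^sup>+\<omega>\<in>A. Y t \<omega> \<partial>P)" if A: "A \<in> sets (F t)" for t A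
  proof -
    let ?s = "Suc t"
    have rF: "r ?s \<in> borel_measurable (F t)" and zF: "z ?s \<in> F t \<rightarrow>\<^sub>M Rvec (d - 1)"
      and lF[measurable]: "l ?s \<in> borel_measurable (F t)"
      and \<kappa>t: "cond_distribution P (F t) (L ?s) (\<kappa> ?s)"
      using r[of ?s] z[of ?s] l_meas[of ?s] \<kappa>[of ?s] by simp_all
    \<comment> \<open>The new factor with its loss replaced by a free variable \<open>x\<close>; all
      other ingredients are known at time \<open>t\<close>.\<close>
    define B where "B x \<omega> = ennreal (1 - l ?s \<omega>) + ennreal (l ?s \<omega>) * e (x, r ?s \<omega>, z ?s \<omega>)" for x \<omega>
    have eF[measurable]: "(\<lambda>y. e (fst y, r ?s (snd y), z ?s (snd y))) \<in> borel_measurable (borel \<Otimes>\<^sub>M F t)"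
      by (intro measurable_compose[OF _ e_meas] measurable_Pair measurable_fst
          measurable_compose[OF measurable_snd rF] measurable_compose[OF measurable_snd zF])
    have BF: "(\<lambda>y. B (fst y) (snd y)) \<in> borel_measurable (borel \<Otimes>\<^sub>M F t)"
      unfolding B_def by measurable
    have Bx: "(\<lambda>x. B x \<omega>) \<in> borel_measurable borel" if "\<omega> \<in> space P" for \<omega>
      using measurable_compose[OF measurable_Pair2'[of \<omega> "F t" borel] BF] that space_F by simp
    \<comment> \<open>Evaluated at \<open>(L (Suc t) \<omega>, \<omega>)\<close>, this is the
      integrand of \<open>Y (Suc t)\<close> over \<open>A\<close>, in the form required for
      disintegration.\<close>
    define h where "h y = indicator A (snd y) * Y t (snd y) * B (fst y) (snd y)" for y
    have h_meas: "h \<in> borel_measurable (borel \<Otimes>\<^sub>M F t)"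
      unfolding h_def[abs_def]
      by (intro borel_measurable_times_ennreal BF measurable_compose[OF measurable_snd Y_meas]
          measurable_compose[OF measurable_snd borel_measurable_indicator[OF A]])
    have \<kappa>m: "\<kappa> ?s \<in> F t \<rightarrow>\<^sub>M prob_algebra borel"
      using \<kappa>t unfolding cond_distribution_def by (rule conjunct1)
    \<comment> \<open>The null hypothesis is moved from the versions \<open>\<rho>L\<close> and
      \<open>\<phi>L\<close> to the functionals evaluated at \<open>\<kappa>\<close>.\<close>
    have adm: "AE \<omega> in P. enat ?s \<le> T \<omega> \<longrightarrow>
        \<kappa> ?s \<omega> \<in> \<M> \<and> \<rho> (\<kappa> ?s \<omega>) \<le> r ?s \<omega> \<and> z ?s \<omega> = \<phi> (\<kappa> ?s \<omega>)"
    proof -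
      have null: "AE \<omega> in P. enat ?s \<le> T \<omega> \<longrightarrow> r ?s \<omega> \<ge> \<rho>L ?s \<omega> \<and> z ?s \<omega> = \<phi>L ?s \<omega>"
        by (rule eventually_mono[OF H0]) simp
      have s1: "1 \<le> ?s" by simp
      from null \<kappa>_in[OF s1] \<rho>L(2)[OF s1] \<phi>L(2)[OF s1]
      show ?thesis by eventually_elim simp
    qed
    have le: "AE \<omega> in P. (\<integral>\<^sup>+x. h (x, \<omega>) \<partial>\<kappa> ?s \<omega>) \<le> Y t \<omega> * indicator A \<omega>"
    proof (rule AE_mp[OF adm], rule AE_I2, rule impI)
      fix \<omega> assume \<omega>: "\<omega> \<in> space P"
      assume H: "enat ?s \<le> T \<omega> \<longrightarrow>
        \<kappa> ?s \<omega> \<in> \<M> \<and> \<rho> (\<kappa> ?s \<omega>) \<le> r ?s \<omega> \<and> z ?s \<omega> = \<phi> (\<kappa> ?s \<omega>)"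
      have "\<kappa> ?s \<omega> \<in> space (prob_algebra borel)"
        using measurable_space[OF \<kappa>m] \<omega> space_F by blast
      then have \<kappa>p: "prob_space (\<kappa> ?s \<omega>)" and \<kappa>s: "sets (\<kappa> ?s \<omega>) = sets borel"
        by (auto simp: space_prob_algebra)
      have "(\<integral>\<^sup>+x. B x \<omega> \<partial>\<kappa> ?s \<omega>) \<le> 1"
      \<comment> \<open>Up to the horizon the e-statistic gives the bound. Afterwards
        \<open>\<kappa>\<close> may lie outside \<open>\<M>\<close>, but the bet is 0 and the factor
        is constantly 1.\<close>
      proof (cases "enat ?s \<le> T \<omega>")
        case True
        then have D: "\<kappa> ?s \<omega> \<in> \<M>" "\<rho> (\<kappa> ?s \<omega>) \<le> r ?s \<omega>" "z ?s \<omega> = \<phi> (\<kappa> ?s \<omega>)"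
          using H by auto
        show ?thesis
          unfolding B_def D(3)
          by (rule one_sided_e_statistic_bet_le_one[OF e D(1) \<M>[OF D(1)] D(2) \<phi>[OF D(1)]])
            (use l01 \<omega> in auto)
      next
        case False
        then show ?thesis
          using prob_space.emeasure_space_1[OF \<kappa>p] by (simp add: B_def l_def)
      qed
      then have "indicator A \<omega> * Y t \<omega> * (\<integral>\<^sup>+x. B x \<omega> \<partial>\<kappa> ?s \<omega>) \<le> indicator A \<omega> * Y t \<omega> * 1"
        by (intro mult_left_mono) auto
      moreover have "(\<integral>\<^sup>+x. indicator A \<omega> * Y t \<omega> * B x \<omega> \<partial>\<kappa> ?s \<omega>) =
          indicator A \<omega> * Y t \<omega> * (\<integral>\<^sup>+x. B x \<omega> \<partial>\<kappa> ?s \<omega>)"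
        by (rule nn_integral_cmult) (use Bx[OF \<omega>] in \<open>simp add: measurable_cong_sets[OF \<kappa>s refl]\<close>)
      ultimately show "(\<integral>\<^sup>+x. h (x, \<omega>) \<partial>\<kappa> ?s \<omega>) \<le> Y t \<omega> * indicator A \<omega>"
        by (simp add: h_def mult.commute)
    qed
    have "(\<integral>\<^sup>+\<omega>\<in>A. Y ?s \<omega> \<partial>P) = (\<integral>\<^sup>+\<omega>. h (L ?s \<omega>, \<omega>) \<partial>P)"
      by (intro nn_integral_cong) (simp add: h_def Y_def e_process_rec[of "Suc t"] B_def X mult_ac)
    also have "\<dots> = (\<integral>\<^sup>+\<omega>. (\<integral>\<^sup>+x. h (x, \<omega>) \<partial>\<kappa> ?s \<omega>) \<partial>P)"
      by (rule nn_integral_cond_distribution[OF prob filt(2) measurable_from_subalg[OF filt(2) L] \<kappa>t h_meas])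
    also have "\<dots> \<le> (\<integral>\<^sup>+\<omega>\<in>A. Y t \<omega> \<partial>P)"
      by (rule nn_integral_mono_AE[OF le])
    finally show ?thesis .
  qed
  have Y0: "(\<integral>\<^sup>+\<omega>. Y 0 \<omega> \<partial>P) = 1"
    by (simp add: Y_def e_process_0 P.emeasure_space_1)
  have sm: "nonneg_supermartingale P F Y"
    by (rule nonneg_supermartingaleI[OF prob filt Y_meas _ step]) (simp add: Y0)
  have [measurable]: "Y t \<in> borel_measurable P" for t
    by (rule measurable_from_subalg[OF filt(2) Y_meas])
  \<comment> \<open>The left index set varies with \<open>\<omega>\<close>. The right side is a
    countable supremum of measurable functions, which also makes the crossing event
    measurable.\<close>
  have sup_eq: "(SUP t\<in>{t. enat t \<le> T \<omega>}. M t \<omega>) = (SUP t. Y t \<omega>)" for \<omega>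
    using arg_cong[OF range_stopped[of T M \<omega>], of Sup] by (simp add: Y_eq)
  have "measure P {\<omega> \<in> space P. ennreal (1 / \<alpha>) \<le> (SUP t. Y t \<omega>)} \<le> \<alpha>" (is "measure P ?S \<le> \<alpha>")
    if "0 < \<alpha>" for \<alpha> :: real
  proof -
    have "ennreal (1 / \<alpha>) * emeasure P ?S \<le> 1"
      using ville_inequality[OF prob filt sm] by (simp add: Y0)
    then have "1 / \<alpha> * measure P ?S \<le> 1"
      using that by (simp add: P.emeasure_eq_measure flip: ennreal_mult ennreal_1)
    then show ?thesis using that by (simp add: field_simps)
  qed
  moreover have "stopped T M = Y"
    by (intro ext Y_eq)
  ultimately show ?thesis
    unfolding nonneg_supermartingale_upto_def sup_eq
    using sm by (auto simp: M e_process_0)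
qed

end
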